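(* Let $k\ge2$, $q\ge1$ and let $\mathbf{v}\in W_{k,q}$ with $0<v_1<\cdots<v_{k-1}<q-1$ (so that all vertices of $F=F(\mathbf{v},\mathrm{Id})$ lie in the interior of $R_{k,q}$). Then the number of facets of the star cluster $SC_{T_{k,q}}(F)$ equals $X_{k+1}$.
   Context: $R_{k,q}=\{\mathbf{x}\in\mathbb{R}^{k-1}:0\le x_1\le\cdots\le x_{k-1}\le q\}$, $W_{k,q}=R_{k,q}\cap\mathbb{Z}^{k-1}$. A permutation $\pi$ of $[k-1]$ is consistent with $\mathbf{u}\in W_{k,q}$ if $i$ precedes $i+1$ in $\pi$ whenever $u_i=u_{i+1}$; then $F(\mathbf{u},\pi)$ is the simplex with vertices $\mathbf{u}^{(1)}=\mathbf{u}$, $\mathbf{u}^{(m+1)}=\mathbf{u}^{(m)}+e_{\pi_{k-m}}$ ($m=1,\ldots,k-1$). $T_{k,q}$ is the simplicial complex on $W_{k,q}$ whose facets are all such $F(\mathbf{u},\pi)$; $\mathrm{Id}$ is the identity permutation. $\mathrm{star}_K(\mathbf{w})$ is the union of all faces containing $\mathbf{w}$ and $SC_K(\sigma)=\bigcup_{\mathbf{w}\in\sigma}\mathrm{star}_K(\mathbf{w})$. For $\pi\in\mathbb{S}_n$, $\mathrm{init}(\pi)=\min\{t:\{\pi_1,\ldots,\pi_t\}=[t]\}$, and $X_n=|\{\pi\in\mathbb{S}_n:\mathrm{init}(\pi)=n\}|$. *)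

theory Defs
  imports Complex_Main "HOL-Combinatorics.Permutations"
begin

text \<open>Vectors in $R^{k-1}$ are functions on \<^typ>\<open>nat\<close> supported on the indices \<open>1, \<dots>, k - 1\<close>;
  the support condition makes distinct functions represent distinct vectors, so that
  cardinalities are counted correctly.\<close>

definition R_region :: "nat \<Rightarrow> nat \<Rightarrow> (nat \<Rightarrow> real) set" where
  "R_region k q = {x. (\<forall>i. i \<notin> {1..k-1} \<longrightarrow> x i = 0) \<and>
     0 \<le> x 1 \<and> (\<forall>i\<in>{1..<k-1}. x i \<le> x (i + 1)) \<and> x (k - 1) \<le> real q}"

definition W_points :: "nat \<Rightarrow> nat \<Rightarrow> (nat \<Rightarrow> int) set" where
  "W_points k q = {u. (\<lambda>i. real_of_int (u i)) \<in> R_region k q}"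

text \<open>A permutation is given in one-line notation by its values \<open>\<pi> 1, \<pi> 2, \<dots>\<close>, so
  \<open>inv \<pi> i\<close> is the position of \<open>i\<close>.\<close>

definition consistent :: "nat \<Rightarrow> (nat \<Rightarrow> int) \<Rightarrow> (nat \<Rightarrow> nat) \<Rightarrow> bool" where
  "consistent k u \<pi> \<longleftrightarrow> (\<forall>i\<in>{1..<k-1}. u i = u (i + 1) \<longrightarrow> inv \<pi> i < inv \<pi> (i + 1))"

text \<open>\<open>F_vertex k u \<pi> j\<close> is $u^{(j+1)}$; in particular the step from \<open>j\<close> to \<open>j + 1\<close> adds
  $e_{\pi_{k-m}}$ with $m = j + 1$.\<close>

primrec F_vertex :: "nat \<Rightarrow> (nat \<Rightarrow> int) \<Rightarrow> (nat \<Rightarrow> nat) \<Rightarrow> nat \<Rightarrow> nat \<Rightarrow> int" where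
  "F_vertex k u \<pi> 0 = u"
| "F_vertex k u \<pi> (Suc j) =
     (\<lambda>i. F_vertex k u \<pi> j i + (if i = \<pi> (k - (j + 1)) then 1 else 0))"

text \<open>Simplices are represented by their vertex sets, and complexes by their sets of simplices
  (including the empty one).\<close>

definition F_simplex :: "nat \<Rightarrow> (nat \<Rightarrow> int) \<Rightarrow> (nat \<Rightarrow> nat) \<Rightarrow> (nat \<Rightarrow> int) set" where
  "F_simplex k u \<pi> = F_vertex k u \<pi> ` {0..k-1}"

text \<open>The complex has vertex set \<open>W_points k q\<close>, hence the requirement
  \<open>F_simplex k u \<pi> \<subseteq> W_points k q\<close>: when $u_{k-1} = q$ the simplex sticks out of the region.\<close>

definition T_complex :: "nat \<Rightarrow> nat \<Rightarrow> (nat \<Rightarrow> int) set set" where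
  "T_complex k q = {\<sigma>. \<exists>u \<pi>. u \<in> W_points k q \<and> \<pi> permutes {1..k-1} \<and> consistent k u \<pi> \<and>
     F_simplex k u \<pi> \<subseteq> W_points k q \<and> \<sigma> \<subseteq> F_simplex k u \<pi>}"

text \<open>The union of all closed faces containing \<open>w\<close>, as a subcomplex.\<close>

definition star :: "'a set set \<Rightarrow> 'a \<Rightarrow> 'a set set" where
  "star K w = (\<Union>\<sigma>\<in>{\<sigma> \<in> K. w \<in> \<sigma>}. Pow \<sigma>)"

definition star_cluster :: "'a set set \<Rightarrow> 'a set \<Rightarrow> 'a set set" where
  "star_cluster K \<sigma> = (\<Union>w\<in>\<sigma>. star K w)"

definition facets :: "'a set set \<Rightarrow> 'a set set" where
  "facets K = {\<sigma> \<in> K. \<forall>\<tau>\<in>K. \<sigma> \<subseteq> \<tau> \<longrightarrow> \<sigma> = \<tau>}"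

definition perm_init :: "(nat \<Rightarrow> nat) \<Rightarrow> nat" where
  "perm_init \<pi> = (LEAST t. 1 \<le> t \<and> \<pi> ` {1..t} = {1..t})"

definition X_number :: "nat \<Rightarrow> nat" where
  "X_number n = card {\<pi>. \<pi> permutes {1..n} \<and> perm_init \<pi> = n}"

end

theory Submission
  imports Defs
begin

text \<open>Adjoin to the unit steps \<open>e\<^sub>1, \<dots>, e\<^sub>k\<^sub>-\<^sub>1\<close> a further step \<open>e\<^sub>k = - (1, \<dots>, 1)\<close>, so that all \<open>k\<close> steps sum
  to zero. The vertices of \<open>F(u, \<pi>)\<close> then form a closed cycle using every step once, so the simplices
  through an interior point \<open>w\<close> correspond to the permutations of \<open>[k]\<close>: the order in which the steps
  are undone when the cycle is traversed backwards from \<open>w\<close>. Classify the facets of the star cluster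
  by the first vertex \<open>w\<^sub>j\<close> of \<open>F\<close> that they contain. After relabelling the steps, those with first vertex
  \<open>w\<^sub>j\<close> correspond to the permutations of \<open>[k]\<close> that map no \<open>[t]\<close> with \<open>1 \<le> t \<le> j\<close> to itself. Inserting
  the value \<open>k + 1\<close> at position \<open>j + 1\<close> turns these into the indecomposable permutations of \<open>[k + 1]\<close>
  having \<open>k + 1\<close> at that position.\<close>

subsection \<open>Permutations and their prefixes\<close>

text \<open>The value at \<open>x\<close> is what the prefix of length \<open>x\<close> has beyond
  the one of length \<open>x - 1\<close>.\<close>

lemma permutes_eq_if_prefixes_eq:
  fixes \<sigma> \<rho> :: "nat \<Rightarrow> nat"
  assumes "\<sigma> permutes {1..k}" "\<rho> permutes {1..k}"
    and prefixes: "\<And>t. t \<le> k \<Longrightarrow> \<sigma> ` {1..t} = \<rho> ` {1..t}"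
  shows "\<sigma> = \<rho>"
proof
  fix x
  show "\<sigma> x = \<rho> x"
  proof (cases "x \<in> {1..k}")
    case True
    then have diff: "{x} = {1..x} - {1..x-1}" by auto
    have "\<tau> ` {x} = \<tau> ` {1..x} - \<tau> ` {1..x-1}" if "\<tau> permutes {1..k}" for \<tau>
      unfolding diff by (rule image_set_diff) (rule permutes_inj[OF that])
    moreover have "\<sigma> ` {1..x} = \<rho> ` {1..x}" "\<sigma> ` {1..x-1} = \<rho> ` {1..x-1}"
      using True by (auto intro!: prefixes simp del: One_nat_def)
    ultimately have "\<sigma> ` {x} = \<rho> ` {x}"
      using assms(1,2) by (simp only:)
    then show ?thesis by simp
  next
    case False
    then show ?thesis using assms(1,2) by (simp add: permutes_not_in)
  qed
qed

lemma card_prefix: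
  fixes \<sigma> :: "nat \<Rightarrow> nat"
  assumes "\<sigma> permutes {1..k}"
  shows "card (\<sigma> ` {1..t}) = t"
  by (simp add: card_image permutes_inj_on[OF assms])

lemma prefix_psubset:
  fixes \<sigma> :: "nat \<Rightarrow> nat"
  assumes \<sigma>: "\<sigma> permutes {1..k}" and "t < k"
  shows "\<sigma> ` {1..t} \<subset> {1..k}"
proof -
  have "\<sigma> ` {1..t} \<subseteq> \<sigma> ` {1..k}" using \<open>t < k\<close> by (intro image_mono) auto
  moreover have "\<sigma> ` {1..t} \<noteq> {1..k}"
    using card_prefix[OF \<sigma>, of t] \<open>t < k\<close> by auto
  ultimately show ?thesis using permutes_image[OF \<sigma>] by auto
qed

text \<open>The rotation of \<open>[k]\<close> with one-line notation \<open>k - m, \<dots>, k, 1, \<dots>, k - m - 1\<close>.\<close>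

definition rotation :: "nat \<Rightarrow> nat \<Rightarrow> nat \<Rightarrow> nat" where
  "rotation k m t =
     (if 1 \<le> t \<and> t \<le> m + 1 then k - m + t - 1 else if m + 1 < t \<and> t \<le> k then t - m - 1 else t)"

lemma rotation_permutes:
  assumes "m < k"
  shows "rotation k m permutes {1..k}"
proof (rule bij_imp_permutes)
  show "bij_betw (rotation k m) {1..k} {1..k}"
    by (rule bij_betw_byWitness[where f' = "\<lambda>s. if k - m \<le> s then s + 1 + m - k else s + m + 1"])
      (use assms in \<open>auto simp: rotation_def\<close>)
  show "rotation k m t = t" if "t \<notin> {1..k}" for t
    using that assms by (auto simp: rotation_def)
qed

text \<open>Prefixes of the rotation are cyclic intervals starting at \<open>k - m\<close>. The
  value \<open>k\<close>, which will stand for the extra step, enters at length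
  \<open>m + 1\<close>; hence the split into a low and a high case.\<close>

lemma rotation_prefix_low:
  assumes "m < k" "t \<le> m"
  shows "rotation k m ` {1..t} = {k-m..<k-m+t}"
proof -
  have "x \<in> rotation k m ` {1..t}" if "x \<in> {k-m..<k-m+t}" for x
    by (rule image_eqI[where x = "x + 1 + m - k"]) (use that assms in \<open>auto simp: rotation_def\<close>)
  moreover have "rotation k m ` {1..t} \<subseteq> {k-m..<k-m+t}"
    using assms by (auto simp: rotation_def)
  ultimately show ?thesis by blast
qed

lemma rotation_prefix_high:
  assumes "m < t" "t \<le> k"
  shows "rotation k m ` {1..t} = {k-m..k} \<union> {1..t-m-1}"
proof -
  have "x \<in> rotation k m ` {1..t}" if "x \<in> {k-m..k}" for x
    by (rule image_eqI[where x = "x + 1 + m - k"]) (use that assms in \<open>auto simp: rotation_def\<close>)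
  moreover have "x \<in> rotation k m ` {1..t}" if "x \<in> {1..t-m-1}" for x
    by (rule image_eqI[where x = "x + m + 1"]) (use that assms in \<open>auto simp: rotation_def\<close>)
  moreover have "rotation k m ` {1..t} \<subseteq> {k-m..k} \<union> {1..t-m-1}"
    using assms by (auto simp: rotation_def)
  ultimately show ?thesis by blast
qed

text \<open>Interpolates between all permutations of \<open>[k]\<close> (\<open>j = 0\<close>) and
  the indecomposable ones (\<open>j = k - 1\<close>).\<close>

definition no_fixed_prefix :: "nat \<Rightarrow> nat \<Rightarrow> (nat \<Rightarrow> nat) set" where
  "no_fixed_prefix k j = {\<rho>. \<rho> permutes {1..k} \<and> (\<forall>t\<in>{1..j}. \<rho> ` {1..t} \<noteq> {1..t})}"

text \<open>Left composition with \<open>c\<close> turns comparison with the prefixes of the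
  identity into comparison with those of \<open>c\<close>, so the choice of reference permutation
  does not affect the count.\<close>

lemma card_differing_prefixes:
  assumes c: "c permutes {1..k}"
  shows "card {\<sigma>. \<sigma> permutes {1..k} \<and> (\<forall>t\<in>{1..j}. \<sigma> ` {1..t} \<noteq> c ` {1..t})}
    = card (no_fixed_prefix k j)"
proof -
  define D where "D = {\<sigma>. \<sigma> permutes {1..k} \<and> (\<forall>t\<in>{1..j}. \<sigma> ` {1..t} \<noteq> c ` {1..t})}"
  have prefix: "(c \<circ> \<rho>) ` {1..t} = c ` {1..t} \<longleftrightarrow> \<rho> ` {1..t} = {1..t}" for \<rho> :: "nat \<Rightarrow> nat" and t
    by (simp only: image_comp[symmetric] inj_image_eq_iff[OF permutes_inj[OF c]])
  have inv_comp: "inv c \<circ> (c \<circ> \<rho>) = \<rho>" and comp_inv: "c \<circ> (inv c \<circ> \<rho>) = \<rho>"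
    for \<rho> :: "nat \<Rightarrow> nat"
    by (simp_all add: comp_assoc[symmetric] permutes_inv_o[OF c])
  have "bij_betw ((\<circ>) c) (no_fixed_prefix k j) D"
  proof (rule bij_betw_byWitness[where f' = "(\<circ>) (inv c)"])
    show "(\<circ>) c ` no_fixed_prefix k j \<subseteq> D"
      unfolding D_def no_fixed_prefix_def using prefix permutes_compose[OF _ c] by blast
    show "(\<circ>) (inv c) ` D \<subseteq> no_fixed_prefix k j"
    proof (rule image_subsetI)
      fix \<sigma> assume \<sigma>: "\<sigma> \<in> D"
      then have "inv c \<circ> \<sigma> permutes {1..k}"
        unfolding D_def using permutes_compose[OF _ permutes_inv[OF c]] by blast
      moreover have "\<forall>t\<in>{1..j}. (inv c \<circ> \<sigma>) ` {1..t} \<noteq> {1..t}"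
        using \<sigma> prefix[of "inv c \<circ> \<sigma>"] unfolding comp_inv D_def by blast
      ultimately show "inv c \<circ> \<sigma> \<in> no_fixed_prefix k j" unfolding no_fixed_prefix_def by blast
    qed
  qed (simp_all add: inv_comp comp_inv del: o_apply)
  then show ?thesis unfolding D_def by (rule bij_betw_same_card[symmetric])
qed

subsection \<open>Indecomposable permutations by the position of the largest value\<close>

lemma perm_init_eq_iff:
  assumes \<tau>: "\<tau> permutes {1..n}" and "n \<ge> 1"
  shows "perm_init \<tau> = n \<longleftrightarrow> (\<forall>t\<in>{1..<n}. \<tau> ` {1..t} \<noteq> {1..t})"
proof
  assume "perm_init \<tau> = n"
  then show "\<forall>t\<in>{1..<n}. \<tau> ` {1..t} \<noteq> {1..t}"
    unfolding perm_init_def by (metis (mono_tags, lifting) atLeastLessThan_iff not_less_Least)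
next
  assume "\<forall>t\<in>{1..<n}. \<tau> ` {1..t} \<noteq> {1..t}"
  then show "perm_init \<tau> = n"
    unfolding perm_init_def
    by (intro Least_equality) (use assms permutes_image[OF \<tau>] in \<open>force simp: not_less[symmetric]\<close>)+
qed

text \<open>Composing with \<open>insert_pos k j\<close> on the right moves the last of \<open>k + 1\<close> entries to position
  \<open>j + 1\<close>.\<close>

definition insert_pos :: "nat \<Rightarrow> nat \<Rightarrow> nat \<Rightarrow> nat" where
  "insert_pos k j t = (if t = j + 1 then k + 1 else if j + 1 < t \<and> t \<le> k + 1 then t - 1 else t)"

lemma insert_pos_permutes:
  assumes "j \<le> k"
  shows "insert_pos k j permutes {1..k+1}"
proof (rule bij_imp_permutes)
  show "bij_betw (insert_pos k j) {1..k+1} {1..k+1}"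
    by (rule bij_betw_byWitness
        [where f' = "\<lambda>s. if s = k + 1 then j + 1 else if j + 1 \<le> s then s + 1 else s"])
      (use assms in \<open>auto simp: insert_pos_def\<close>)
  show "insert_pos k j t = t" if "t \<notin> {1..k+1}" for t
    using that assms by (auto simp: insert_pos_def)
qed

lemma insert_pos_prefix: "t \<le> j \<Longrightarrow> insert_pos k j ` {1..t} = {1..t}"
  by (force simp: insert_pos_def image_iff)

text \<open>Sort by the position \<open>j + 1\<close> of the value \<open>k + 1\<close>. Prefixes of
  length at most \<open>j\<close> survive the deletion of that value unchanged; a longer one
  contains \<open>k + 1\<close>, so it cannot be \<open>[t]\<close> with
  \<open>t \<le> k\<close>.\<close>

lemma X_number_Suc:
  assumes "k \<ge> 1"
  shows "X_number (k + 1) = (\<Sum>j<k. card (no_fixed_prefix k j))"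
proof -
  define I where "I j = {\<tau>. \<tau> permutes {1..k+1} \<and> (\<forall>t\<in>{1..k}. \<tau> ` {1..t} \<noteq> {1..t}) \<and> \<tau> (j + 1) = k + 1}"
    for j
  have "{\<tau>. \<tau> permutes {1..k+1} \<and> perm_init \<tau> = k + 1} = (\<Union>j<k. I j)"
  proof (intro equalityI subsetI)
    fix \<tau> assume "\<tau> \<in> {\<tau>. \<tau> permutes {1..k+1} \<and> perm_init \<tau> = k + 1}"
    then have \<tau>: "\<tau> permutes {1..k+1}" and indec: "\<forall>t\<in>{1..k}. \<tau> ` {1..t} \<noteq> {1..t}"
      using perm_init_eq_iff[of \<tau> "k + 1"] by auto
    have "k + 1 \<in> \<tau> ` {1..k+1}" using permutes_image[OF \<tau>] by simp
    then obtain p where p: "p \<in> {1..k+1}" "\<tau> p = k + 1" by force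
    \<comment> \<open>If the largest value stood last, the prefix of length \<open>k\<close> would
      be \<open>[k]\<close>.\<close>
    have "p \<noteq> k + 1"
    proof
      assume "p = k + 1"
      have "{1..k} = {1..k+1} - {k+1}" by auto
      then have "\<tau> ` {1..k} = \<tau> ` {1..k+1} - \<tau> ` {k+1}"
        using image_set_diff[OF permutes_inj[OF \<tau>]] by metis
      also have "\<dots> = {1..k}" using p \<open>p = k + 1\<close> permutes_image[OF \<tau>] by auto
      finally show False using indec assms by auto
    qed
    then have "p - 1 < k" "\<tau> (p - 1 + 1) = k + 1" using p by auto
    then show "\<tau> \<in> (\<Union>j<k. I j)" using \<tau> indec unfolding I_def by blast
  next
    fix \<tau> assume "\<tau> \<in> (\<Union>j<k. I j)"
    then show "\<tau> \<in> {\<tau>. \<tau> permutes {1..k+1} \<and> perm_init \<tau> = k + 1}"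
      using perm_init_eq_iff[of \<tau> "k + 1"] by (auto simp: I_def)
  qed
  then have "X_number (k + 1) = card (\<Union>j<k. I j)" by (simp add: X_number_def)
  also have "\<dots> = (\<Sum>j<k. card (I j))"
  proof (rule card_UN_disjoint)
    show "\<forall>j\<in>{..<k}. finite (I j)"
      by (auto simp: I_def intro: finite_subset[OF _ finite_permutations[of "{1..k+1}"]])
    show "\<forall>i\<in>{..<k}. \<forall>j\<in>{..<k}. i \<noteq> j \<longrightarrow> I i \<inter> I j = {}"
      by (auto simp: I_def dest!: permutes_inj) (metis Suc_inject injD)
  qed simp
  also have "\<dots> = (\<Sum>j<k. card (no_fixed_prefix k j))"
  proof (rule sum.cong)
    fix j assume "j \<in> {..<k}"
    then have "j < k" by simp
    then have d: "insert_pos k j permutes {1..k+1}" by (intro insert_pos_permutes) simp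
    have prefix: "(\<sigma> \<circ> insert_pos k j) ` {1..t} = \<sigma> ` {1..t}" if "t \<le> j" for \<sigma> :: "nat \<Rightarrow> nat" and t
      using insert_pos_prefix[OF that] by (metis image_comp)
    have "bij_betw (\<lambda>\<rho>. \<rho> \<circ> insert_pos k j) (no_fixed_prefix k j) (I j)"
    proof (rule bij_betw_byWitness[where f' = "\<lambda>\<tau>. \<tau> \<circ> inv (insert_pos k j)"])
      show "\<forall>\<rho>\<in>no_fixed_prefix k j. (\<rho> \<circ> insert_pos k j) \<circ> inv (insert_pos k j) = \<rho>"
        by (simp add: comp_assoc permutes_inv_o[OF d])
      show "\<forall>\<tau>\<in>I j. (\<tau> \<circ> inv (insert_pos k j)) \<circ> insert_pos k j = \<tau>"
        by (simp add: comp_assoc permutes_inv_o[OF d])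
      show "(\<lambda>\<rho>. \<rho> \<circ> insert_pos k j) ` no_fixed_prefix k j \<subseteq> I j"
      proof (rule image_subsetI)
        fix \<rho> assume "\<rho> \<in> no_fixed_prefix k j"
        then have \<rho>: "\<rho> permutes {1..k}" and low: "\<forall>t\<in>{1..j}. \<rho> ` {1..t} \<noteq> {1..t}"
          by (auto simp: no_fixed_prefix_def)
        have last: "(\<rho> \<circ> insert_pos k j) (j + 1) = k + 1"
          using permutes_not_in[OF \<rho>, of "k + 1"] by (simp add: insert_pos_def)
        have "(\<rho> \<circ> insert_pos k j) ` {1..t} \<noteq> {1..t}" if "t \<in> {1..k}" for t
        proof (cases "t \<le> j")
          case True
          then show ?thesis using low that by (simp only: prefix) auto
        next
          case False
          then have "(\<rho> \<circ> insert_pos k j) (j + 1) \<in> (\<rho> \<circ> insert_pos k j) ` {1..t}"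
            by (intro imageI) auto
          then have "k + 1 \<in> (\<rho> \<circ> insert_pos k j) ` {1..t}" unfolding last .
          moreover have "k + 1 \<notin> {1..t}" using that by auto
          ultimately show ?thesis by metis
        qed
        moreover have "\<rho> \<circ> insert_pos k j permutes {1..k+1}"
          by (rule permutes_compose[OF d permutes_subset[OF \<rho>]]) auto
        ultimately show "\<rho> \<circ> insert_pos k j \<in> I j" using last by (simp add: I_def)
      qed
      show "(\<lambda>\<tau>. \<tau> \<circ> inv (insert_pos k j)) ` I j \<subseteq> no_fixed_prefix k j"
      proof (rule image_subsetI)
        fix \<tau> assume "\<tau> \<in> I j"
        then have \<tau>: "\<tau> permutes {1..k+1}" and indec: "\<forall>t\<in>{1..k}. \<tau> ` {1..t} \<noteq> {1..t}"
          and last: "\<tau> (j + 1) = k + 1" by (auto simp: I_def)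
        define \<rho> where "\<rho> = \<tau> \<circ> inv (insert_pos k j)"
        have \<rho>: "\<rho> permutes {1..k+1}"
          unfolding \<rho>_def by (rule permutes_compose[OF permutes_inv[OF d] \<tau>])
        have \<tau>_eq: "\<tau> = \<rho> \<circ> insert_pos k j"
          by (simp add: \<rho>_def comp_assoc permutes_inv_o[OF d])
        then have "\<rho> (k + 1) = k + 1" using last by (simp add: insert_pos_def)
        then have "\<rho> permutes {1..k}"
          by (intro permutes_superset[OF \<rho>]) (auto simp: le_Suc_eq)
        moreover have "\<rho> ` {1..t} \<noteq> {1..t}" if "t \<in> {1..j}" for t
          using indec that \<open>j < k\<close> prefix[of t \<rho>] \<tau>_eq by auto
        ultimately show "\<tau> \<circ> inv (insert_pos k j) \<in> no_fixed_prefix k j"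
          by (simp add: no_fixed_prefix_def \<rho>_def)
      qed
    qed
    then show "card (I j) = card (no_fixed_prefix k j)" by (rule bij_betw_same_card[symmetric])
  qed simp
  finally show ?thesis .
qed

subsection \<open>Simplices as cycles of steps\<close>

text \<open>Step \<open>i < k\<close> is the unit vector \<open>e\<^sub>i\<close>, and step \<open>k\<close> is \<open>- (1, \<dots>, 1)\<close>.\<close>

definition undo_steps :: "nat \<Rightarrow> (nat \<Rightarrow> int) \<Rightarrow> nat set \<Rightarrow> nat \<Rightarrow> int" where
  "undo_steps k w B = (\<lambda>i. w i - of_bool (i \<in> B \<and> i < k) + of_bool (k \<in> B \<and> 1 \<le> i \<and> i < k))"

text \<open>Undoing all \<open>k\<close> steps leads back to \<open>w\<close>, so the lengths
  \<open>t < k\<close> cover the whole cycle, with \<open>w\<close> itself at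
  \<open>t = 0\<close>.\<close>

definition cycle_simplex :: "nat \<Rightarrow> (nat \<Rightarrow> int) \<Rightarrow> (nat \<Rightarrow> nat) \<Rightarrow> (nat \<Rightarrow> int) set" where
  "cycle_simplex k w \<sigma> = (\<lambda>t. undo_steps k w (\<sigma> ` {1..t})) ` {..<k}"

text \<open>Up to scaling, the only linear relation among the steps is that their total vanishes. So
  two different sets of steps can have the same sum only if one is empty and the other is all of
  \<open>[k]\<close>, which properness excludes.\<close>

lemma undo_steps_inj:
  assumes B: "B \<subset> {1..k}" and C: "C \<subset> {1..k}" and eq: "undo_steps k w B = undo_steps k w C"
  shows "B = C"
proof -
  have pointwise: "of_bool (k \<in> B) - of_bool (i \<in> B) = (of_bool (k \<in> C) - of_bool (i \<in> C) :: int)"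
    if "1 \<le> i" "i < k" for i
    using fun_cong[OF eq, of i] that by (simp add: undo_steps_def)
  \<comment> \<open>If \<open>k\<close> lay in \<open>B'\<close> only, every coordinate would force
    its own step into \<open>B'\<close>, making \<open>B'\<close> all of \<open>[k]\<close>. Stated
    for generic sets so that it applies in both directions.\<close>
  have k_mem: "k \<in> C'" if "k \<in> B'" "B' \<subset> {1..k}"
    and eq': "\<And>i. 1 \<le> i \<Longrightarrow> i < k \<Longrightarrow>
      of_bool (k \<in> B') - of_bool (i \<in> B') = (of_bool (k \<in> C') - of_bool (i \<in> C') :: int)" for B' C'
  proof (rule ccontr)
    assume "k \<notin> C'"
    then have "i \<in> B'" if "1 \<le> i" "i < k" for i
      using \<open>k \<in> B'\<close> eq'[OF that] by (auto simp: of_bool_def split: if_splits)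
    then have "{1..k} \<subseteq> B'" using \<open>k \<in> B'\<close> by (auto simp: le_less)
    then show False using \<open>B' \<subset> {1..k}\<close> by auto
  qed
  have k: "k \<in> B \<longleftrightarrow> k \<in> C"
    using k_mem[OF _ B pointwise] k_mem[OF _ C pointwise[symmetric]] by blast
  show ?thesis
  proof (rule set_eqI)
    fix i
    consider "i = k" | "1 \<le> i" "i < k" | "i \<notin> {1..k}" by force
    then show "i \<in> B \<longleftrightarrow> i \<in> C"
    proof cases
      case 2
      then show ?thesis using pointwise[OF 2] k by (auto simp: of_bool_def split: if_splits)
    qed (use B C k in auto)
  qed
qed

lemma undo_prefix_eq_iff:
  assumes "\<sigma> permutes {1..k}" "\<rho> permutes {1..k}" "s < k" "t < k"
  shows "undo_steps k w (\<sigma> ` {1..s}) = undo_steps k w (\<rho> ` {1..t}) \<longleftrightarrow> s = t \<and> \<sigma> ` {1..s} = \<rho> ` {1..t}"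
  using undo_steps_inj prefix_psubset[OF assms(1,3)] prefix_psubset[OF assms(2,4)]
    card_prefix[OF assms(1), of s] card_prefix[OF assms(2), of t] by metis

text \<open>The dictionary between geometry and permutations. A vertex determines the set of undone
  steps, whose size is the prefix length, so only the prefix of \<open>\<sigma>\<close> of the same
  length \<open>t\<close> can match.\<close>

lemma undo_prefix_mem_cycle_simplex_iff:
  assumes "\<sigma> permutes {1..k}" "\<rho> permutes {1..k}" "t < k"
  shows "undo_steps k w (\<rho> ` {1..t}) \<in> cycle_simplex k w \<sigma> \<longleftrightarrow> \<sigma> ` {1..t} = \<rho> ` {1..t}"
  using undo_prefix_eq_iff[OF assms(2,1)] assms(3) by (auto simp: cycle_simplex_def image_iff)

lemma card_cycle_simplex:
  assumes "\<sigma> permutes {1..k}"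
  shows "card (cycle_simplex k w \<sigma>) = k"
proof -
  have "inj_on (\<lambda>t. undo_steps k w (\<sigma> ` {1..t})) {..<k}"
    using undo_prefix_eq_iff[OF assms assms] by (intro inj_onI) auto
  then show ?thesis by (simp add: cycle_simplex_def card_image)
qed

text \<open>By the dictionary, the vertices of a simplex based at \<open>w\<close> reveal every
  prefix of its permutation.\<close>

lemma cycle_simplex_inj: "inj_on (cycle_simplex k w) {\<sigma>. \<sigma> permutes {1..k}}"
proof (rule inj_onI, clarify)
  fix \<sigma> \<rho> assume \<sigma>: "\<sigma> permutes {1..k}" and \<rho>: "\<rho> permutes {1..k}"
    and eq: "cycle_simplex k w \<sigma> = cycle_simplex k w \<rho>"
  show "\<sigma> = \<rho>"
  proof (rule permutes_eq_if_prefixes_eq[OF \<sigma> \<rho>])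
    fix t assume "t \<le> k"
    show "\<sigma> ` {1..t} = \<rho> ` {1..t}"
    proof (cases "t = k")
      case True
      then show ?thesis using permutes_image[OF \<sigma>] permutes_image[OF \<rho>] by simp
    next
      case False
      then have "t < k" using \<open>t \<le> k\<close> by simp
      then have "undo_steps k w (\<rho> ` {1..t}) \<in> cycle_simplex k w \<sigma>"
        unfolding eq by (auto simp: cycle_simplex_def)
      then show ?thesis using undo_prefix_mem_cycle_simplex_iff[OF \<sigma> \<rho> \<open>t < k\<close>] by simp
    qed
  qed
qed

lemma F_vertex_eq:
  assumes \<pi>: "\<pi> permutes {1..k-1}" and "j < k"
  shows "F_vertex k u \<pi> j = (\<lambda>i. u i + of_bool (i \<in> \<pi> ` {k-j..<k}))"
  using \<open>j < k\<close>
proof (induction j)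
  case 0
  then show ?case by auto
next
  case (Suc j)
  have split: "{k - Suc j..<k} = insert (k - Suc j) {k-j..<k}" using Suc.prems by auto
  have "\<pi> (k - Suc j) \<notin> \<pi> ` {k-j..<k}"
    using Suc.prems by (simp add: inj_image_mem_iff[OF permutes_inj[OF \<pi>]])
  then show ?case using Suc unfolding split by (auto simp: fun_eq_iff of_bool_def)
qed

text \<open>Going back from vertex \<open>m\<close> undoes the steps \<open>\<pi> (k - m)\<close>,
  ..., \<open>\<pi> (k - 1)\<close> down to vertex \<open>0\<close>. Undoing step \<open>k\<close>
  adds \<open>(1, ..., 1)\<close> and jumps to vertex \<open>k - 1\<close>; then
  \<open>\<pi> 1\<close>, \<open>\<pi> 2\<close>, ... are undone. This order is
  \<open>\<pi> \<circ> rotation k m\<close>.\<close>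

lemma undo_steps_F_vertex:
  assumes \<pi>: "\<pi> permutes {1..k-1}" and "m < k" "t < k"
  shows "undo_steps k (F_vertex k u \<pi> m) ((\<pi> \<circ> rotation k m) ` {1..t})
    = F_vertex k u \<pi> (if t \<le> m then m - t else k + m - t)"
proof -
  have inv_iff: "i \<in> \<pi> ` A \<longleftrightarrow> inv \<pi> i \<in> A" for i A
    using permutes_inverses[OF \<pi>] by (metis image_iff)
  \<comment> \<open>Neither the extra step \<open>k\<close> nor the coordinate \<open>0\<close>,
    which lies outside the support, is moved by \<open>\<pi>\<close>.\<close>
  have inv_k: "inv \<pi> k = k" and inv_0: "inv \<pi> 0 = 0"
    using permutes_not_in[OF permutes_inv[OF \<pi>]] \<open>m < k\<close> by auto
  have inv_mem: "inv \<pi> i \<in> {1..k-1} \<longleftrightarrow> i \<in> {1..k-1}" for i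
    using permutes_in_image[OF permutes_inv[OF \<pi>]] by auto
  have "(if t \<le> m then m - t else k + m - t) < k" using assms by auto
  note vertex = F_vertex_eq[OF \<pi> \<open>m < k\<close>] F_vertex_eq[OF \<pi> this]
  show ?thesis
  proof (cases "t \<le> m")
    case True
    have rot: "(\<pi> \<circ> rotation k m) ` {1..t} = \<pi> ` {k-m..<k-m+t}"
      using rotation_prefix_low[OF \<open>m < k\<close> True] by (metis image_comp)
    show ?thesis
      unfolding rot vertex
    proof (rule ext, unfold undo_steps_def)
      fix i
      show "u i + of_bool (i \<in> \<pi> ` {k-m..<k}) - of_bool (i \<in> \<pi> ` {k-m..<k-m+t} \<and> i < k)
          + of_bool (k \<in> \<pi> ` {k-m..<k-m+t} \<and> 1 \<le> i \<and> i < k)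
        = u i + of_bool (i \<in> \<pi> ` {k-(if t \<le> m then m - t else k + m - t)..<k})"
        unfolding inv_iff inv_k using True \<open>m < k\<close> inv_mem[of i] inv_0 by (cases "i = 0") (auto simp: of_bool_def)
    qed
  next
    case False
    have rot: "(\<pi> \<circ> rotation k m) ` {1..t} = \<pi> ` ({k-m..k} \<union> {1..t-m-1})"
      using rotation_prefix_high[of m t k] False \<open>t < k\<close> by (metis image_comp less_imp_le not_le)
    show ?thesis
      unfolding rot vertex
    proof (rule ext, unfold undo_steps_def)
      fix i
      show "u i + of_bool (i \<in> \<pi> ` {k-m..<k}) - of_bool (i \<in> \<pi> ` ({k-m..k} \<union> {1..t-m-1}) \<and> i < k)
          + of_bool (k \<in> \<pi> ` ({k-m..k} \<union> {1..t-m-1}) \<and> 1 \<le> i \<and> i < k)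
        = u i + of_bool (i \<in> \<pi> ` {k-(if t \<le> m then m - t else k + m - t)..<k})"
        unfolding inv_iff inv_k using False \<open>m < k\<close> \<open>t < k\<close> inv_mem[of i] inv_0 by (cases "i = 0") (auto simp: of_bool_def)
    qed
  qed
qed

text \<open>Any vertex may serve as base point: changing it only rotates the cycle.\<close>

lemma F_simplex_eq_cycle_simplex:
  assumes \<pi>: "\<pi> permutes {1..k-1}" and "m < k"
  shows "F_simplex k u \<pi> = cycle_simplex k (F_vertex k u \<pi> m) (\<pi> \<circ> rotation k m)"
proof -
  have "cycle_simplex k (F_vertex k u \<pi> m) (\<pi> \<circ> rotation k m)
    = F_vertex k u \<pi> ` (\<lambda>t. if t \<le> m then m - t else k + m - t) ` {..<k}"
    unfolding cycle_simplex_def image_image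
    by (rule image_cong) (use undo_steps_F_vertex[OF assms] in auto)
  \<comment> \<open>The index map is the reflection of \<open>t\<close> to \<open>m - t\<close>
    modulo \<open>k\<close>, hence its own inverse; this supplies the witness.\<close>
  also have "(\<lambda>t. if t \<le> m then m - t else k + m - t) ` {..<k} = {0..k-1}"
  proof -
    have "l \<in> (\<lambda>t. if t \<le> m then m - t else k + m - t) ` {..<k}" if "l \<in> {0..k-1}" for l
      by (rule image_eqI[where x = "if l \<le> m then m - l else k + m - l"])
        (use that \<open>m < k\<close> in auto)
    moreover have "(\<lambda>t. if t \<le> m then m - t else k + m - t) ` {..<k} \<subseteq> {0..k-1}"
      using \<open>m < k\<close> by auto
    ultimately show ?thesis by blast
  qed
  finally show ?thesis unfolding F_simplex_def ..
qed

lemma perm_comp_rotation_permutes: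
  assumes "\<pi> permutes {1..k-1}" "m < k"
  shows "\<pi> \<circ> rotation k m permutes {1..k}"
  by (rule permutes_compose[OF rotation_permutes permutes_subset]) (use assms in auto)

lemma card_F_simplex:
  assumes "\<pi> permutes {1..k-1}" "k \<ge> 1"
  shows "card (F_simplex k u \<pi>) = k"
  using F_simplex_eq_cycle_simplex[of \<pi> k 0 u] card_cycle_simplex perm_comp_rotation_permutes[of \<pi> k 0]
    assms by simp

text \<open>The position \<open>m + 1\<close> of step \<open>k\<close> in \<open>\<sigma>\<close>
  tells that \<open>w\<close> is vertex \<open>m\<close>. Rotating the cycle so that
  \<open>k\<close> comes last leaves a permutation of \<open>[k - 1]\<close>, and undoing
  \<open>m\<close> steps from \<open>w\<close> gives \<open>u\<close>.\<close>

lemma cycle_simplex_eq_F_simplex: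
  assumes \<sigma>: "\<sigma> permutes {1..k}" and "k \<ge> 1"
  obtains u \<pi> m where "\<pi> permutes {1..k-1}" "m < k" "w = F_vertex k u \<pi> m"
    "cycle_simplex k w \<sigma> = F_simplex k u \<pi>"
proof -
  have "k \<in> \<sigma> ` {1..k}" using permutes_image[OF \<sigma>] \<open>k \<ge> 1\<close> by auto
  then obtain p where p: "p \<in> {1..k}" "\<sigma> p = k" by force
  define m where "m = p - 1"
  have "m < k" "p = m + 1" using p by (auto simp: m_def)
  note c = rotation_permutes[OF \<open>m < k\<close>]
  define \<pi> where "\<pi> = \<sigma> \<circ> inv (rotation k m)"
  have \<sigma>_eq: "\<sigma> = \<pi> \<circ> rotation k m" by (simp add: \<pi>_def comp_assoc permutes_inv_o[OF c])
  have \<pi>_k: "\<pi> permutes {1..k}" unfolding \<pi>_def by (rule permutes_compose[OF permutes_inv[OF c] \<sigma>])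
  have "\<pi> k = k"
  proof -
    have "rotation k m p = k" using \<open>p = m + 1\<close> \<open>m < k\<close> by (simp add: rotation_def)
    then show ?thesis using p(2) \<sigma>_eq by (metis comp_apply)
  qed
  moreover have "{1..k} - {1..k-1} = {k}" using \<open>k \<ge> 1\<close> by auto
  ultimately have \<pi>: "\<pi> permutes {1..k-1}" by (intro permutes_superset[OF \<pi>_k]) simp
  define u where "u = (\<lambda>i. w i - of_bool (i \<in> \<pi> ` {k-m..<k}))"
  have w: "w = F_vertex k u \<pi> m"
    using F_vertex_eq[OF \<pi> \<open>m < k\<close>] by (simp add: u_def)
  show thesis
    using that[OF \<pi> \<open>m < k\<close> w] F_simplex_eq_cycle_simplex[OF \<pi> \<open>m < k\<close>] w \<sigma>_eq by simp
qed

subsection \<open>Simplices meeting the interior\<close>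

text \<open>The simplices that generate \<open>T_complex k q\<close>.\<close>

definition T_facets :: "nat \<Rightarrow> nat \<Rightarrow> (nat \<Rightarrow> int) set set" where
  "T_facets k q = {F_simplex k u \<pi> |u \<pi>. u \<in> W_points k q \<and> \<pi> permutes {1..k-1} \<and>
     consistent k u \<pi> \<and> F_simplex k u \<pi> \<subseteq> W_points k q}"

definition W_interior :: "nat \<Rightarrow> nat \<Rightarrow> (nat \<Rightarrow> int) set" where
  "W_interior k q = {w. (\<forall>i. i \<notin> {1..k-1} \<longrightarrow> w i = 0) \<and>
     0 < w 1 \<and> (\<forall>i\<in>{1..<k-1}. w i < w (i + 1)) \<and> w (k - 1) < int q}"

lemma W_points_iff:
  "u \<in> W_points k q \<longleftrightarrow> (\<forall>i. i \<notin> {1..k-1} \<longrightarrow> u i = 0) \<and>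
     0 \<le> u 1 \<and> (\<forall>i\<in>{1..<k-1}. u i \<le> u (i + 1)) \<and> u (k - 1) \<le> int q"
proof -
  have "real_of_int (u (k - 1)) \<le> real q \<longleftrightarrow> u (k - 1) \<le> int q" by linarith
  then show ?thesis by (simp add: W_points_def R_region_def)
qed

text \<open>Between two vertices of a simplex each coordinate changes by at most 1. Strict
  inequalities between integers at one vertex therefore leave enough slack for the weak ones at all
  vertices.\<close>

lemma F_simplex_in_T_facets:
  assumes \<pi>: "\<pi> permutes {1..k-1}" and "m < k" "k \<ge> 2"
    and interior: "F_vertex k u \<pi> m \<in> W_interior k q"
  shows "F_simplex k u \<pi> \<in> T_facets k q"
proof -
  have inv_iff: "i \<in> \<pi> ` A \<longleftrightarrow> inv \<pi> i \<in> A" for i A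
    using permutes_inverses[OF \<pi>] by (metis image_iff)
  have inv_mem: "inv \<pi> i \<in> {1..k-1} \<longleftrightarrow> i \<in> {1..k-1}" for i
    using permutes_in_image[OF permutes_inv[OF \<pi>]] by auto
  have vertex: "F_vertex k u \<pi> l i = u i + of_bool (i \<in> {1..k-1} \<and> k - l \<le> inv \<pi> i)"
    if "l < k" for l i
    unfolding F_vertex_eq[OF \<pi> that] inv_iff using inv_mem[of i] that by (auto simp: of_bool_def)
  have u0: "u i = 0" if "i \<notin> {1..k-1}" for i
    using interior that vertex[OF \<open>m < k\<close>, of i]
    by (auto simp: W_interior_def of_bool_def split: if_splits)
  have first: "0 \<le> u 1" and last: "u (k - 1) + 1 \<le> int q"
    using interior vertex[OF \<open>m < k\<close>, of 1] vertex[OF \<open>m < k\<close>, of "k - 1"]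
    by (auto simp: W_interior_def of_bool_def split: if_splits)
  \<comment> \<open>If \<open>u i = u (i + 1)\<close>, strictness at vertex \<open>m\<close> means
    that \<open>i + 1\<close> has already been raised there and \<open>i\<close> has not. Steps are
    taken from the end of \<open>\<pi>\<close>, so \<open>i\<close> precedes \<open>i + 1\<close>;
    this is consistency.\<close>
  have step: "u i < u (i + 1) \<or> u i = u (i + 1) \<and> inv \<pi> i < inv \<pi> (i + 1)" if "i \<in> {1..<k-1}" for i
  proof -
    have "F_vertex k u \<pi> m i < F_vertex k u \<pi> m (i + 1)"
      using interior that by (simp add: W_interior_def)
    then show ?thesis using vertex[OF \<open>m < k\<close>] that by (auto simp: of_bool_def split: if_splits)
  qed
  have "F_vertex k u \<pi> l \<in> W_points k q" if "l < k" for l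
    unfolding W_points_iff
  proof (intro conjI allI impI ballI)
    show "F_vertex k u \<pi> l i = 0" if "i \<notin> {1..k-1}" for i
      using vertex[OF \<open>l < k\<close>, of i] u0[OF that] that by auto
    show "0 \<le> F_vertex k u \<pi> l 1"
      using vertex[OF \<open>l < k\<close>, of 1] first by simp
    show "F_vertex k u \<pi> l i \<le> F_vertex k u \<pi> l (i + 1)" if "i \<in> {1..<k-1}" for i
      using vertex[OF \<open>l < k\<close>] step[OF that] that by (auto simp: of_bool_def)
    show "F_vertex k u \<pi> l (k - 1) \<le> int q"
      using vertex[OF \<open>l < k\<close>, of "k - 1"] last by (auto simp: of_bool_def)
  qed
  then have sub: "F_simplex k u \<pi> \<subseteq> W_points k q"
    using \<open>k \<ge> 2\<close> by (auto simp: F_simplex_def)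
  moreover have "u \<in> F_simplex k u \<pi>"
    unfolding F_simplex_def by (rule image_eqI[where x = 0]) auto
  moreover have "consistent k u \<pi>"
    using step by (force simp: consistent_def)
  ultimately show ?thesis using \<pi> unfolding T_facets_def by blast
qed

text \<open>At an interior point neither consistency nor the boundary excludes any order of the
  steps.\<close>

lemma T_facets_through_interior:
  assumes w: "w \<in> W_interior k q" and "k \<ge> 2"
  shows "{S \<in> T_facets k q. w \<in> S} = cycle_simplex k w ` {\<sigma>. \<sigma> permutes {1..k}}"
proof (intro equalityI subsetI)
  fix S assume "S \<in> {S \<in> T_facets k q. w \<in> S}"
  then obtain u \<pi> where \<pi>: "\<pi> permutes {1..k-1}" and S: "S = F_simplex k u \<pi>" "w \<in> S"
    by (auto simp: T_facets_def)
  then obtain m where "m \<in> {0..k-1}" and w_eq: "w = F_vertex k u \<pi> m"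
    by (auto simp: F_simplex_def)
  then have m: "m < k" using \<open>k \<ge> 2\<close> by auto
  show "S \<in> cycle_simplex k w ` {\<sigma>. \<sigma> permutes {1..k}}"
    using F_simplex_eq_cycle_simplex[OF \<pi> m] perm_comp_rotation_permutes[OF \<pi> m]
    unfolding S(1) w_eq by (intro image_eqI CollectI)
next
  fix S assume "S \<in> cycle_simplex k w ` {\<sigma>. \<sigma> permutes {1..k}}"
  then obtain \<sigma> where \<sigma>: "\<sigma> permutes {1..k}" and S: "S = cycle_simplex k w \<sigma>" by auto
  have "k \<ge> 1" using \<open>k \<ge> 2\<close> by simp
  obtain u \<pi> m where \<pi>: "\<pi> permutes {1..k-1}" and m: "m < k" and w_eq: "w = F_vertex k u \<pi> m"
    and S_eq: "cycle_simplex k w \<sigma> = F_simplex k u \<pi>"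
    by (rule cycle_simplex_eq_F_simplex[OF \<sigma> \<open>k \<ge> 1\<close>])
  have "S \<in> T_facets k q"
    unfolding S S_eq by (rule F_simplex_in_T_facets[OF \<pi> m \<open>k \<ge> 2\<close> w[unfolded w_eq]])
  moreover have "F_vertex k u \<pi> m \<in> F_simplex k u \<pi>"
    unfolding F_simplex_def by (rule imageI) (use m in auto)
  then have "w \<in> S" unfolding S S_eq w_eq[symmetric] .
  ultimately show "S \<in> {S \<in> T_facets k q. w \<in> S}" by simp
qed

text \<open>A face through a vertex of \<open>F\<close> extends to a generator through it, so the
  generators meeting \<open>F\<close> generate the star cluster. Having equal size, none properly
  contains another.\<close>

lemma facets_star_cluster:
  assumes A: "\<And>S. S \<in> A \<Longrightarrow> finite S \<and> card S = n"
  shows "facets (star_cluster {\<sigma>. \<exists>S\<in>A. \<sigma> \<subseteq> S} F) = {S \<in> A. S \<inter> F \<noteq> {}}"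
proof -
  have cluster: "star_cluster {\<sigma>. \<exists>S\<in>A. \<sigma> \<subseteq> S} F = {\<sigma>. \<exists>S\<in>A. S \<inter> F \<noteq> {} \<and> \<sigma> \<subseteq> S}"
    unfolding star_cluster_def star_def by blast
  show ?thesis
    unfolding cluster
  proof (intro equalityI subsetI)
    fix \<sigma> assume "\<sigma> \<in> facets {\<sigma>. \<exists>S\<in>A. S \<inter> F \<noteq> {} \<and> \<sigma> \<subseteq> S}"
    then obtain S where "S \<in> A" "S \<inter> F \<noteq> {}" "\<sigma> = S" unfolding facets_def by blast
    then show "\<sigma> \<in> {S \<in> A. S \<inter> F \<noteq> {}}" by simp
  next
    fix S assume S: "S \<in> {S \<in> A. S \<inter> F \<noteq> {}}"
    have "S = \<tau>" if "T \<in> A" "\<tau> \<subseteq> T" "S \<subseteq> \<tau>" for T \<tau>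
    proof -
      have "S = T" using card_subset_eq[of T S] A S that by auto
      then show ?thesis using that by blast
    qed
    then show "S \<in> facets {\<sigma>. \<exists>S\<in>A. S \<inter> F \<noteq> {} \<and> \<sigma> \<subseteq> S}"
      unfolding facets_def using S by blast
  qed
qed

section \<open>Counting the facets by the first vertex of \<open>F\<close> that they contain\<close>

theorem mainTheorem14:
  fixes k q :: nat and v :: "nat \<Rightarrow> int"
  assumes "k \<ge> 2" and "q \<ge> 1"
    and "v \<in> W_points k q"
    and "0 < v 1" and "\<forall>i\<in>{1..<k-1}. v i < v (i + 1)" and "v (k - 1) < int q - 1"
  shows "card (facets (star_cluster (T_complex k q) (F_simplex k v id))) = X_number (k + 1)"
proof -
  define w where "w = F_vertex k v id"
  have F: "F_simplex k v id = w ` {..<k}"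
    using assms(1) by (auto simp: F_simplex_def w_def)
  have id: "id permutes {1..k-1}" by (rule permutes_id)
  \<comment> \<open>Vertex \<open>j\<close> raises the last \<open>j\<close> coordinates of
    \<open>v\<close> by 1, which preserves strict increase; \<open>v (k - 1) < q - 1\<close> keeps
    the last one below \<open>q\<close>.\<close>
  have interior: "w j \<in> W_interior k q" if "j < k" for j
    unfolding w_def F_vertex_eq[OF id that] W_interior_def
    using assms that by (auto simp: of_bool_def W_points_iff)
  \<comment> \<open>Since \<open>F\<close> belongs to \<open>id\<close>, its own cycle read
    backwards from \<open>w j\<close> is \<open>rotation k j\<close>.\<close>
  define C where "C j = {\<sigma>. \<sigma> permutes {1..k} \<and> (\<forall>t\<in>{1..j}. \<sigma> ` {1..t} \<noteq> rotation k j ` {1..t})}" for j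
  define N where "N j = {S \<in> T_facets k q. w j \<in> S \<and> (\<forall>i<j. w i \<notin> S)}" for j
  have N_eq: "N j = cycle_simplex k (w j) ` C j" if "j < k" for j
  proof -
    \<comment> \<open>On the cycle of \<open>F\<close>, \<open>w i\<close> is reached from
      \<open>w j\<close> by undoing \<open>j - i\<close> steps, so only prefixes of that length are
      compared.\<close>
    have mem: "w i \<in> cycle_simplex k (w j) \<sigma> \<longleftrightarrow> \<sigma> ` {1..j-i} = rotation k j ` {1..j-i}"
      if "i < j" "\<sigma> permutes {1..k}" for i \<sigma>
    proof -
      have "w i = undo_steps k (w j) (rotation k j ` {1..j-i})"
        using undo_steps_F_vertex[OF id \<open>j < k\<close>, of "j - i" v] that \<open>j < k\<close> by (simp add: w_def)
      then show ?thesis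
        using undo_prefix_mem_cycle_simplex_iff[OF that(2) rotation_permutes[OF \<open>j < k\<close>], of "j - i"]
          \<open>j < k\<close> by simp
    qed
    have reindex: "(\<forall>i<j. P (j - i)) \<longleftrightarrow> (\<forall>t\<in>{1..j}. P t)" for P
    proof
      assume *: "\<forall>i<j. P (j - i)"
      show "\<forall>t\<in>{1..j}. P t"
      proof
        fix t assume "t \<in> {1..j}"
        then show "P t" using *[rule_format, of "j - t"] by simp
      qed
    qed auto
    have first: "(\<forall>i<j. w i \<notin> cycle_simplex k (w j) \<sigma>) \<longleftrightarrow>
        (\<forall>t\<in>{1..j}. \<sigma> ` {1..t} \<noteq> rotation k j ` {1..t})" if "\<sigma> permutes {1..k}" for \<sigma>
      using mem[OF _ that] reindex[of "\<lambda>t. \<sigma> ` {1..t} \<noteq> rotation k j ` {1..t}"] by auto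
    have "N j = {S \<in> cycle_simplex k (w j) ` {\<sigma>. \<sigma> permutes {1..k}}. \<forall>i<j. w i \<notin> S}"
      using T_facets_through_interior[OF interior[OF that] assms(1)] by (auto simp: N_def)
    also have "\<dots> = cycle_simplex k (w j) ` C j"
      using first by (auto simp: C_def)
    finally show ?thesis .
  qed
  have card_N: "card (N j) = card (no_fixed_prefix k j)" if "j < k" for j
  proof -
    have "inj_on (cycle_simplex k (w j)) (C j)"
      by (rule inj_on_subset[OF cycle_simplex_inj]) (auto simp: C_def)
    then have "card (N j) = card (C j)" unfolding N_eq[OF that] by (rule card_image)
    then show ?thesis
      using card_differing_prefixes[OF rotation_permutes[OF that], of j] by (simp add: C_def)
  qed
  have finite_N: "finite (N j)" if "j < k" for j
    unfolding N_eq[OF that] C_def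
    by (intro finite_imageI finite_subset[OF _ finite_permutations[of "{1..k}"]]) auto
  have "T_complex k q = {\<sigma>. \<exists>S\<in>T_facets k q. \<sigma> \<subseteq> S}"
    unfolding T_complex_def T_facets_def by blast
  moreover have "finite S \<and> card S = k" if "S \<in> T_facets k q" for S
    using that card_F_simplex[of _ k] assms(1) by (auto simp: T_facets_def F_simplex_def)
  ultimately have "facets (star_cluster (T_complex k q) (F_simplex k v id))
      = {S \<in> T_facets k q. S \<inter> w ` {..<k} \<noteq> {}}"
    using facets_star_cluster[of "T_facets k q" k] by (simp add: F)
  also have "\<dots> = (\<Union>j<k. N j)"
  proof (intro equalityI subsetI)
    fix S assume S: "S \<in> {S \<in> T_facets k q. S \<inter> w ` {..<k} \<noteq> {}}"
    then obtain i where i: "i < k" "w i \<in> S" by auto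
    \<comment> \<open>The minimum ranges over all naturals, but \<open>j \<le> i < k\<close> ensures
      that \<open>w j\<close> is a vertex of \<open>F\<close>.\<close>
    define j where "j = (LEAST j. w j \<in> S)"
    have "w j \<in> S" "j \<le> i" "\<forall>l<j. w l \<notin> S"
      unfolding j_def using i(2) by (auto intro: LeastI Least_le dest: not_less_Least)
    then show "S \<in> (\<Union>j<k. N j)" using S i(1) by (auto simp: N_def intro!: bexI[of _ j])
  qed (auto simp: N_def)
  finally have "card (facets (star_cluster (T_complex k q) (F_simplex k v id))) = card (\<Union>j<k. N j)"
    by simp
  also have "\<dots> = (\<Sum>j<k. card (N j))"
  proof (rule card_UN_disjoint)
    have "N i \<inter> N j = {}" if "i < j" for i j using that by (auto simp: N_def)
    then show "\<forall>i\<in>{..<k}. \<forall>j\<in>{..<k}. i \<noteq> j \<longrightarrow> N i \<inter> N j = {}"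
      by (metis inf_commute linorder_neqE_nat)
  qed (use finite_N in auto)
  also have "\<dots> = X_number (k + 1)"
    using X_number_Suc[of k] card_N assms(1) by simp
  finally show ?thesis .
qed

end
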